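(* Let $L$ be any one of the sequent calculi $\mathrm{sC3}$, $\mathrm{sMC}$, $\mathrm{sCN}$. Then the rule (cut) is admissible in cut-free $L$. That is, for all finite sets $\Gamma,\Sigma$ of formulas and all formulas $\alpha,\gamma$: if $\Gamma\Rightarrow\alpha$ and $\alpha,\Sigma\Rightarrow\gamma$ are both provable in $L-(\mathrm{cut})$, then $\Gamma,\Sigma\Rightarrow\gamma$ is provable in $L-(\mathrm{cut})$.
   Context: Formulas are built from countably many propositional variables $p,q,\dots$ using the binary connectives $\land,\lor,\to$ and the unary connective $\sim$. A sequent is an expression $\Gamma\Rightarrow\gamma$ with $\Gamma$ a finite (possibly empty) set of formulas and $\gamma$ a single formula; $\alpha,\Gamma$ means $\{\alpha\}\cup\Gamma$ and $\Gamma,\Delta$ means $\Gamma\cup\Delta$. The calculus $\mathrm{sC}$ has the following initial sequents and rules ($p$ any propositional variable; $\alpha,\beta,\gamma$ any formulas; $\Gamma,\Delta,\Sigma$ any finite sets of formulas). Initial sequents: (init1) $p,\Gamma\Rightarrow p$; (init2) $\sim p,\Gamma\Rightarrow\sim p$. (cut): from $\Gamma\Rightarrow\alpha$ and $\alpha,\Sigma\Rightarrow\gamma$ infer $\Gamma,\Sigma\Rightarrow\gamma$. ($\to$left): from $\Gamma\Rightarrow\alpha$ and $\beta,\Delta\Rightarrow\gamma$ infer $\alpha\to\beta,\Gamma,\Delta\Rightarrow\gamma$. ($\to$right): from $\alpha,\Gamma\Rightarrow\beta$ infer $\Gamma\Rightarrow\alpha\to\beta$. ($\land$left): from $\alpha,\beta,\Gamma\Rightarrow\gamma$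 infer $\alpha\land\beta,\Gamma\Rightarrow\gamma$. ($\land$right): from $\Gamma\Rightarrow\alpha$ and $\Gamma\Rightarrow\beta$ infer $\Gamma\Rightarrow\alpha\land\beta$. ($\lor$left): from $\alpha,\Gamma\Rightarrow\gamma$ and $\beta,\Gamma\Rightarrow\gamma$ infer $\alpha\lor\beta,\Gamma\Rightarrow\gamma$. ($\lor$right1), ($\lor$right2): from $\Gamma\Rightarrow\alpha$ (respectively $\Gamma\Rightarrow\beta$) infer $\Gamma\Rightarrow\alpha\lor\beta$. ($\sim$left): from $\alpha,\Gamma\Rightarrow\gamma$ infer $\sim\sim\alpha,\Gamma\Rightarrow\gamma$. ($\sim$right): from $\Gamma\Rightarrow\alpha$ infer $\Gamma\Rightarrow\sim\sim\alpha$. ($\sim\to$left): from $\Gamma\Rightarrow\alpha$ and $\sim\beta,\Delta\Rightarrow\gamma$ infer $\sim(\alpha\to\beta),\Gamma,\Delta\Rightarrow\gamma$. ($\sim\to$right): from $\alpha,\Gamma\Rightarrow\sim\beta$ infer $\Gamma\Rightarrow\sim(\alpha\to\beta)$. ($\sim\land$left): from $\sim\alpha,\Gamma\Rightarrow\gamma$ and $\sim\beta,\Gamma\Rightarrow\gamma$ infer $\sim(\alpha\land\beta),\Gamma\Rightarrow\gamma$. ($\sim\land$right1), ($\sim\land$right2): from $\Gamma\Rightarrow\sim\alpha$ (respectively $\Gamma\Rightarrow\sim\beta$) infer $\Gamma\Rightarrow\sim(\alpha\land\beta)$. ($\sim\lor$left): from $\sim\alpha,\sim\beta,\Gamma\Rightarrow\gamma$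 infer $\sim(\alpha\lor\beta),\Gamma\Rightarrow\gamma$. ($\sim\lor$right): from $\Gamma\Rightarrow\sim\alpha$ and $\Gamma\Rightarrow\sim\beta$ infer $\Gamma\Rightarrow\sim(\alpha\lor\beta)$. Additional rules: (ex-middle): from $\sim\alpha,\Gamma\Rightarrow\gamma$ and $\alpha,\Gamma\Rightarrow\gamma$ infer $\Gamma\Rightarrow\gamma$. (Peirce): from $\alpha\to\beta,\Gamma\Rightarrow\alpha$ infer $\Gamma\Rightarrow\alpha$. $\mathrm{sC3}=\mathrm{sC}+$(ex-middle); $\mathrm{sMC}=\mathrm{sC}+$(Peirce); $\mathrm{sCN}=\mathrm{sC3}+$(Peirce). "Cut-free $L$", written $L-(\mathrm{cut})$, is $L$ without the rule (cut). A rule is admissible in a calculus if, for every instance of it, provability of all premises in the calculus implies provability of the conclusion in the calculus. *)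

theory Defs
  imports "HOL-Library.FSet"
begin

datatype fm =
    Var nat
  | And fm fm  (infixr "\<^bold>\<and>" 75)
  | Or fm fm   (infixr "\<^bold>\<or>" 70)
  | Imp fm fm  (infixr "\<^bold>\<rightarrow>" 65)
  | Neg fm     ("\<^bold>\<sim> _" [80] 80)

datatype sequent = Sequent "fm fset" fm  (infix "\<Rrightarrow>" 50)

(* A rule is the set of its instances (list of premises, conclusion); an initial sequent is an
   instance without premises. A calculus is a set of rules, so that "C - {R}" is the calculus C
   without the rule R: instances of R that also belong to another rule of C stay available. *)
type_synonym rule = "(sequent list \<times> sequent) set"
type_synonym calculus = "rule set"

inductive provable :: "calculus \<Rightarrow> sequent \<Rightarrow> bool" for C where
  rule_app: "\<lbrakk>R \<in> C; (ps, s) \<in> R; \<And>p. p \<in> set ps \<Longrightarrow> provable C p\<rbrakk> \<Longrightarrow> provable C s"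

definition admissible :: "rule \<Rightarrow> calculus \<Rightarrow> bool" where
  "admissible R C \<longleftrightarrow>
    (\<forall>(ps, s) \<in> R. (\<forall>p \<in> set ps. provable C p) \<longrightarrow> provable C s)"

definition init1 :: rule where
  "init1 = {([], finsert (Var p) \<Gamma> \<Rrightarrow> Var p) | p \<Gamma>. True}"

definition init2 :: rule where
  "init2 = {([], finsert (\<^bold>\<sim> Var p) \<Gamma> \<Rrightarrow> \<^bold>\<sim> Var p) | p \<Gamma>. True}"

definition cut_rule :: rule where
  "cut_rule = {([\<Gamma> \<Rrightarrow> \<alpha>, finsert \<alpha> \<Sigma> \<Rrightarrow> \<gamma>], \<Gamma> |\<union>| \<Sigma> \<Rrightarrow> \<gamma>) | \<Gamma> \<Sigma> \<alpha> \<gamma>. True}"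

definition imp_left :: rule where
  "imp_left = {([\<Gamma> \<Rrightarrow> \<alpha>, finsert \<beta> \<Delta> \<Rrightarrow> \<gamma>], finsert (\<alpha> \<^bold>\<rightarrow> \<beta>) (\<Gamma> |\<union>| \<Delta>) \<Rrightarrow> \<gamma>)
    | \<Gamma> \<Delta> \<alpha> \<beta> \<gamma>. True}"

definition imp_right :: rule where
  "imp_right = {([finsert \<alpha> \<Gamma> \<Rrightarrow> \<beta>], \<Gamma> \<Rrightarrow> \<alpha> \<^bold>\<rightarrow> \<beta>) | \<Gamma> \<alpha> \<beta>. True}"

definition and_left :: rule where
  "and_left = {([finsert \<alpha> (finsert \<beta> \<Gamma>) \<Rrightarrow> \<gamma>], finsert (\<alpha> \<^bold>\<and> \<beta>) \<Gamma> \<Rrightarrow> \<gamma>) | \<Gamma> \<alpha> \<beta> \<gamma>. True}"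

definition and_right :: rule where
  "and_right = {([\<Gamma> \<Rrightarrow> \<alpha>, \<Gamma> \<Rrightarrow> \<beta>], \<Gamma> \<Rrightarrow> \<alpha> \<^bold>\<and> \<beta>) | \<Gamma> \<alpha> \<beta>. True}"

definition or_left :: rule where
  "or_left = {([finsert \<alpha> \<Gamma> \<Rrightarrow> \<gamma>, finsert \<beta> \<Gamma> \<Rrightarrow> \<gamma>], finsert (\<alpha> \<^bold>\<or> \<beta>) \<Gamma> \<Rrightarrow> \<gamma>) | \<Gamma> \<alpha> \<beta> \<gamma>. True}"

definition or_right1 :: rule where
  "or_right1 = {([\<Gamma> \<Rrightarrow> \<alpha>], \<Gamma> \<Rrightarrow> \<alpha> \<^bold>\<or> \<beta>) | \<Gamma> \<alpha> \<beta>. True}"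

definition or_right2 :: rule where
  "or_right2 = {([\<Gamma> \<Rrightarrow> \<beta>], \<Gamma> \<Rrightarrow> \<alpha> \<^bold>\<or> \<beta>) | \<Gamma> \<alpha> \<beta>. True}"

definition neg_left :: rule where
  "neg_left = {([finsert \<alpha> \<Gamma> \<Rrightarrow> \<gamma>], finsert (\<^bold>\<sim> \<^bold>\<sim> \<alpha>) \<Gamma> \<Rrightarrow> \<gamma>) | \<Gamma> \<alpha> \<gamma>. True}"

definition neg_right :: rule where
  "neg_right = {([\<Gamma> \<Rrightarrow> \<alpha>], \<Gamma> \<Rrightarrow> \<^bold>\<sim> \<^bold>\<sim> \<alpha>) | \<Gamma> \<alpha>. True}"

definition neg_imp_left :: rule where
  "neg_imp_left = {([\<Gamma> \<Rrightarrow> \<alpha>, finsert (\<^bold>\<sim> \<beta>) \<Delta> \<Rrightarrow> \<gamma>], finsert (\<^bold>\<sim> (\<alpha> \<^bold>\<rightarrow> \<beta>)) (\<Gamma> |\<union>| \<Delta>) \<Rrightarrow> \<gamma>)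
    | \<Gamma> \<Delta> \<alpha> \<beta> \<gamma>. True}"

definition neg_imp_right :: rule where
  "neg_imp_right = {([finsert \<alpha> \<Gamma> \<Rrightarrow> \<^bold>\<sim> \<beta>], \<Gamma> \<Rrightarrow> \<^bold>\<sim> (\<alpha> \<^bold>\<rightarrow> \<beta>)) | \<Gamma> \<alpha> \<beta>. True}"

definition neg_and_left :: rule where
  "neg_and_left = {([finsert (\<^bold>\<sim> \<alpha>) \<Gamma> \<Rrightarrow> \<gamma>, finsert (\<^bold>\<sim> \<beta>) \<Gamma> \<Rrightarrow> \<gamma>], finsert (\<^bold>\<sim> (\<alpha> \<^bold>\<and> \<beta>)) \<Gamma> \<Rrightarrow> \<gamma>)
    | \<Gamma> \<alpha> \<beta> \<gamma>. True}"

definition neg_and_right1 :: rule where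
  "neg_and_right1 = {([\<Gamma> \<Rrightarrow> \<^bold>\<sim> \<alpha>], \<Gamma> \<Rrightarrow> \<^bold>\<sim> (\<alpha> \<^bold>\<and> \<beta>)) | \<Gamma> \<alpha> \<beta>. True}"

definition neg_and_right2 :: rule where
  "neg_and_right2 = {([\<Gamma> \<Rrightarrow> \<^bold>\<sim> \<beta>], \<Gamma> \<Rrightarrow> \<^bold>\<sim> (\<alpha> \<^bold>\<and> \<beta>)) | \<Gamma> \<alpha> \<beta>. True}"

definition neg_or_left :: rule where
  "neg_or_left = {([finsert (\<^bold>\<sim> \<alpha>) (finsert (\<^bold>\<sim> \<beta>) \<Gamma>) \<Rrightarrow> \<gamma>], finsert (\<^bold>\<sim> (\<alpha> \<^bold>\<or> \<beta>)) \<Gamma> \<Rrightarrow> \<gamma>)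
    | \<Gamma> \<alpha> \<beta> \<gamma>. True}"

definition neg_or_right :: rule where
  "neg_or_right = {([\<Gamma> \<Rrightarrow> \<^bold>\<sim> \<alpha>, \<Gamma> \<Rrightarrow> \<^bold>\<sim> \<beta>], \<Gamma> \<Rrightarrow> \<^bold>\<sim> (\<alpha> \<^bold>\<or> \<beta>)) | \<Gamma> \<alpha> \<beta>. True}"

definition ex_middle :: rule where
  "ex_middle = {([finsert (\<^bold>\<sim> \<alpha>) \<Gamma> \<Rrightarrow> \<gamma>, finsert \<alpha> \<Gamma> \<Rrightarrow> \<gamma>], \<Gamma> \<Rrightarrow> \<gamma>) | \<Gamma> \<alpha> \<gamma>. True}"

definition peirce :: rule where
  "peirce = {([finsert (\<alpha> \<^bold>\<rightarrow> \<beta>) \<Gamma> \<Rrightarrow> \<alpha>], \<Gamma> \<Rrightarrow> \<alpha>) | \<Gamma> \<alpha> \<beta>. True}"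

definition sC :: calculus where
  "sC = {init1, init2, cut_rule, imp_left, imp_right, and_left, and_right, or_left, or_right1,
    or_right2,
    neg_left, neg_right, neg_imp_left, neg_imp_right, neg_and_left, neg_and_right1, neg_and_right2,
    neg_or_left, neg_or_right}"

definition sC3 :: calculus where "sC3 = sC \<union> {ex_middle}"
definition sMC :: calculus where "sMC = sC \<union> {peirce}"
definition sCN :: calculus where "sCN = sC3 \<union> {peirce}"

lemma admissible_cut_iff:
  "admissible cut_rule C \<longleftrightarrow>
    (\<forall>\<Gamma> \<Sigma> \<alpha> \<gamma>. provable C (\<Gamma> \<Rrightarrow> \<alpha>) \<longrightarrow> provable C (finsert \<alpha> \<Sigma> \<Rrightarrow> \<gamma>) \<longrightarrow> provable C (\<Gamma> |\<union>| \<Sigma> \<Rrightarrow> \<gamma>))"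
  unfolding admissible_def cut_rule_def by fastforce

(* Rules are compared extensionally, so removing cut_rule must not remove a differently named rule. *)
lemma rule_neq_cut:
  assumes "R \<in> {init1, init2, imp_left, imp_right, and_left, and_right, or_left, or_right1,
    or_right2, neg_left, neg_right, neg_imp_left, neg_imp_right, neg_and_left, neg_and_right1,
    neg_and_right2, neg_or_left, neg_or_right, ex_middle, peirce}"
  shows "R \<noteq> cut_rule"
proof -
  let ?s = "{|Var 0|} \<Rrightarrow> Var 0"
  have "?s = ({|Var 0|} |\<union>| {||} \<Rrightarrow> Var 0)" by simp
  then have "([?s, ?s], ?s) \<in> cut_rule" unfolding cut_rule_def by blast
  moreover have "finsert \<alpha> \<Gamma> = {|Var 0|} \<Longrightarrow> \<alpha> = Var 0" for \<alpha> \<Gamma>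
    by (metis finsertI1 fsingletonD)
  then have "([?s, ?s], ?s) \<notin> R"
    using assms
    by (force simp: init1_def init2_def imp_left_def imp_right_def and_left_def and_right_def
      or_left_def or_right1_def or_right2_def neg_left_def neg_right_def neg_imp_left_def
      neg_imp_right_def neg_and_left_def neg_and_right1_def neg_and_right2_def neg_or_left_def
      neg_or_right_def ex_middle_def peirce_def)
  ultimately show ?thesis by blast
qed

end

(* Up to the shape of its rules for negated formulas, sC is positive intuitionistic logic over the
   atoms p and \<sim>p: a formula \<sim>(\<alpha> \<rightarrow> \<beta>) behaves like \<alpha> \<rightarrow> \<sim>\<beta>, and the other negations follow de Morgan.

   In sC3 Gentzen's argument applies, since (ex-middle) has no principal formula and cuts
   permute above it.

   With (Peirce) cuts do not permute, and cut-free completeness for two-valued semantics is used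
   instead. When the goal g is fixed, a sequent \<Gamma> \<Rightarrow> \<delta>1,...,\<delta>n with several succedents is represented
   by \<Gamma>, \<delta>1 \<rightarrow> g, ..., \<delta>n \<rightarrow> g \<Rightarrow> g; (Peirce) then makes the classical right rules derivable without
   cut. Since cut is sound, the conclusion of a cut is valid and so cut-free provable. *)

theory Submission
  imports Defs
begin

section \<open>Uniform notation\<close>

text \<open>Each of \<open>p\<close> and \<open>\<sim> p\<close> has its own initial sequents and no
  left or right rule introduces either, so within sC the formula \<open>\<sim> p\<close> acts as a
  second atom, independent of \<open>p\<close>.\<close>

inductive literal :: "fm \<Rightarrow> bool" where
  "literal (Var p)"
| "literal (\<^bold>\<sim> Var p)"

text \<open>\<open>\<sim> \<sim> \<alpha>\<close> is classed as a conjunction of \<alpha> with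
  itself, which saves a separate type for its two rules. Contexts are sets, so the repeated
  component disappears.\<close>

inductive conjunctive :: "fm \<Rightarrow> fm \<Rightarrow> fm \<Rightarrow> bool" where
  "conjunctive (\<alpha> \<^bold>\<and> \<beta>) \<alpha> \<beta>"
| "conjunctive (\<^bold>\<sim> (\<alpha> \<^bold>\<or> \<beta>)) (\<^bold>\<sim> \<alpha>) (\<^bold>\<sim> \<beta>)"
| "conjunctive (\<^bold>\<sim> \<^bold>\<sim> \<alpha>) \<alpha> \<alpha>"

inductive disjunctive :: "fm \<Rightarrow> fm \<Rightarrow> fm \<Rightarrow> bool" where
  "disjunctive (\<alpha> \<^bold>\<or> \<beta>) \<alpha> \<beta>"
| "disjunctive (\<^bold>\<sim> (\<alpha> \<^bold>\<and> \<beta>)) (\<^bold>\<sim> \<alpha>) (\<^bold>\<sim> \<beta>)"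

inductive implicative :: "fm \<Rightarrow> fm \<Rightarrow> fm \<Rightarrow> bool" where
  "implicative (\<alpha> \<^bold>\<rightarrow> \<beta>) \<alpha> \<beta>"
| "implicative (\<^bold>\<sim> (\<alpha> \<^bold>\<rightarrow> \<beta>)) \<alpha> (\<^bold>\<sim> \<beta>)"

lemmas type_intros = literal.intros conjunctive.intros disjunctive.intros implicative.intros
lemmas type_simps = literal.simps conjunctive.simps disjunctive.simps implicative.simps

lemma fm_type_cases:
  obtains "literal \<phi>"
  | \<alpha> \<beta> where "conjunctive \<phi> \<alpha> \<beta>"
  | \<alpha> \<beta> where "disjunctive \<phi> \<alpha> \<beta>"
  | \<alpha> \<beta> where "implicative \<phi> \<alpha> \<beta>"
proof -
  have "literal \<phi> \<or> (\<exists>\<alpha> \<beta>. conjunctive \<phi> \<alpha> \<beta> \<or> disjunctive \<phi> \<alpha> \<beta> \<or> implicative \<phi> \<alpha> \<beta>)"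
  proof (cases \<phi>)
    case (Neg \<psi>)
    then show ?thesis by (cases \<psi>) (blast intro: type_intros)+
  qed (blast intro: type_intros)+
  then show ?thesis using that by blast
qed

text \<open>In the inversion proofs below, right rules of a type other than that of the goal have to
  be ruled out, and the components in the remaining rule have to be identified. This lemma and the
  next two serve that purpose.\<close>

lemma not_literal:
  "conjunctive \<phi> \<alpha> \<beta> \<Longrightarrow> \<not> literal \<phi>"
  "disjunctive \<phi> \<alpha> \<beta> \<Longrightarrow> \<not> literal \<phi>"
  "implicative \<phi> \<alpha> \<beta> \<Longrightarrow> \<not> literal \<phi>"
  by (auto simp: type_simps)

lemma type_exclusive:
  "conjunctive \<phi> \<alpha> \<beta> \<Longrightarrow> \<not> disjunctive \<phi> \<alpha>' \<beta>'"
  "conjunctive \<phi> \<alpha> \<beta> \<Longrightarrow> \<not> implicative \<phi> \<alpha>' \<beta>'"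
  "disjunctive \<phi> \<alpha> \<beta> \<Longrightarrow> \<not> implicative \<phi> \<alpha>' \<beta>'"
  by (auto simp: type_simps)

lemma type_unique:
  "conjunctive \<phi> \<alpha> \<beta> \<Longrightarrow> conjunctive \<phi> \<alpha>' \<beta>' \<Longrightarrow> \<alpha>' = \<alpha> \<and> \<beta>' = \<beta>"
  "disjunctive \<phi> \<alpha> \<beta> \<Longrightarrow> disjunctive \<phi> \<alpha>' \<beta>' \<Longrightarrow> \<alpha>' = \<alpha> \<and> \<beta>' = \<beta>"
  "implicative \<phi> \<alpha> \<beta> \<Longrightarrow> implicative \<phi> \<alpha>' \<beta>' \<Longrightarrow> \<alpha>' = \<alpha> \<and> \<beta>' = \<beta>"
  by (auto simp: type_simps)

(* The binary connectives weigh 2, so that \<sim>\<alpha> and \<sim>\<beta> together weigh less than \<sim>(\<alpha> \<and> \<beta>). *)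
fun weight :: "fm \<Rightarrow> nat" where
  "weight (Var p) = 1"
| "weight (\<alpha> \<^bold>\<and> \<beta>) = weight \<alpha> + weight \<beta> + 2"
| "weight (\<alpha> \<^bold>\<or> \<beta>) = weight \<alpha> + weight \<beta> + 2"
| "weight (\<alpha> \<^bold>\<rightarrow> \<beta>) = weight \<alpha> + weight \<beta> + 2"
| "weight (\<^bold>\<sim> \<alpha>) = weight \<alpha> + 1"

lemma weight_disjunctive: "disjunctive \<phi> \<alpha> \<beta> \<Longrightarrow> weight \<alpha> + weight \<beta> < weight \<phi>"
  and weight_implicative: "implicative \<phi> \<alpha> \<beta> \<Longrightarrow> weight \<alpha> + weight \<beta> < weight \<phi>"
  by (auto simp: type_simps)

(* For \<sim>\<sim>\<alpha> the two components coincide and must not be counted twice. *)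
lemma weight_conjunctive: "conjunctive \<phi> \<alpha> \<beta> \<Longrightarrow> sum weight {\<alpha>, \<beta>} < weight \<phi>"
  by (auto simp: type_simps sum.insert_if)

lemma weight_components:
  "conjunctive \<phi> \<alpha> \<beta> \<or> disjunctive \<phi> \<alpha> \<beta> \<or> implicative \<phi> \<alpha> \<beta> \<Longrightarrow>
    weight \<alpha> < weight \<phi> \<and> weight \<beta> < weight \<phi>"
  by (auto simp: type_simps)

section \<open>The cut-free calculi in uniform notation\<close>

text \<open>Left rules keep their principal formula and two-premise rules share the context, so
  contraction is built in and weakening is proved by a plain induction. The flags \<open>em\<close>
  and \<open>pc\<close> switch on (ex-middle) and (Peirce), so that the calculi are treated
  together.\<close>

inductive der :: "bool \<Rightarrow> bool \<Rightarrow> fm fset \<Rightarrow> fm \<Rightarrow> bool" for em pc where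
  init: "literal \<gamma> \<Longrightarrow> \<gamma> |\<in>| \<Gamma> \<Longrightarrow> der em pc \<Gamma> \<gamma>"
| conjL: "conjunctive \<phi> \<alpha> \<beta> \<Longrightarrow> \<phi> |\<in>| \<Gamma> \<Longrightarrow> der em pc (finsert \<alpha> (finsert \<beta> \<Gamma>)) \<gamma> \<Longrightarrow> der em pc \<Gamma> \<gamma>"
| conjR: "conjunctive \<phi> \<alpha> \<beta> \<Longrightarrow> der em pc \<Gamma> \<alpha> \<Longrightarrow> der em pc \<Gamma> \<beta> \<Longrightarrow> der em pc \<Gamma> \<phi>"
| disjL: "disjunctive \<phi> \<alpha> \<beta> \<Longrightarrow> \<phi> |\<in>| \<Gamma> \<Longrightarrow> der em pc (finsert \<alpha> \<Gamma>) \<gamma> \<Longrightarrow>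
    der em pc (finsert \<beta> \<Gamma>) \<gamma> \<Longrightarrow> der em pc \<Gamma> \<gamma>"
| disjR1: "disjunctive \<phi> \<alpha> \<beta> \<Longrightarrow> der em pc \<Gamma> \<alpha> \<Longrightarrow> der em pc \<Gamma> \<phi>"
| disjR2: "disjunctive \<phi> \<alpha> \<beta> \<Longrightarrow> der em pc \<Gamma> \<beta> \<Longrightarrow> der em pc \<Gamma> \<phi>"
| impL: "implicative \<phi> \<alpha> \<beta> \<Longrightarrow> \<phi> |\<in>| \<Gamma> \<Longrightarrow> der em pc \<Gamma> \<alpha> \<Longrightarrow>
    der em pc (finsert \<beta> \<Gamma>) \<gamma> \<Longrightarrow> der em pc \<Gamma> \<gamma>"
| impR: "implicative \<phi> \<alpha> \<beta> \<Longrightarrow> der em pc (finsert \<alpha> \<Gamma>) \<beta> \<Longrightarrow> der em pc \<Gamma> \<phi>"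
| exm: "em \<Longrightarrow> der em pc (finsert (\<^bold>\<sim> \<alpha>) \<Gamma>) \<gamma> \<Longrightarrow> der em pc (finsert \<alpha> \<Gamma>) \<gamma> \<Longrightarrow> der em pc \<Gamma> \<gamma>"
| prc: "pc \<Longrightarrow> der em pc (finsert (\<gamma> \<^bold>\<rightarrow> \<beta>) \<Gamma>) \<gamma> \<Longrightarrow> der em pc \<Gamma> \<gamma>"

lemma weakening: "der em pc \<Gamma> \<gamma> \<Longrightarrow> \<Gamma> |\<subseteq>| \<Delta> \<Longrightarrow> der em pc \<Delta> \<gamma>"
proof (induction arbitrary: \<Delta> rule: der.induct)
  case (conjL \<phi> \<alpha> \<beta> \<Gamma> \<gamma>)
  have "der em pc (finsert \<alpha> (finsert \<beta> \<Delta>)) \<gamma>" by (rule conjL.IH) (use conjL.prems in auto)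
  then show ?case using conjL.hyps conjL.prems by (blast intro: der.conjL)
next
  case (disjL \<phi> \<alpha> \<beta> \<Gamma> \<gamma>)
  have "der em pc (finsert \<alpha> \<Delta>) \<gamma>" by (rule disjL.IH) (use disjL.prems in auto)
  moreover have "der em pc (finsert \<beta> \<Delta>) \<gamma>" by (rule disjL.IH) (use disjL.prems in auto)
  ultimately show ?case using disjL.hyps disjL.prems by (blast intro: der.disjL)
next
  case (impL \<phi> \<alpha> \<beta> \<Gamma> \<gamma>)
  have "der em pc (finsert \<beta> \<Delta>) \<gamma>" by (rule impL.IH) (use impL.prems in auto)
  then show ?case using impL.hyps impL.IH(1) impL.prems by (blast intro: der.impL)
next
  case (impR \<phi> \<alpha> \<beta> \<Gamma>)
  have "der em pc (finsert \<alpha> \<Delta>) \<beta>" by (rule impR.IH) (use impR.prems in auto)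
  then show ?case using impR.hyps by (blast intro: der.impR)
next
  case (exm \<alpha> \<Gamma> \<gamma>)
  have "der em pc (finsert \<alpha> \<Delta>) \<gamma>" by (rule exm.IH) (use exm.prems in auto)
  moreover have "der em pc (finsert (\<^bold>\<sim> \<alpha>) \<Delta>) \<gamma>" by (rule exm.IH) (use exm.prems in auto)
  ultimately show ?case using exm.hyps by (blast intro: der.exm)
next
  case (prc \<gamma> \<beta> \<Gamma>)
  have "der em pc (finsert (\<gamma> \<^bold>\<rightarrow> \<beta>) \<Delta>) \<gamma>" by (rule prc.IH) (use prc.prems in auto)
  then show ?case using prc.hyps by (blast intro: der.prc)
qed (blast intro: init conjR disjR1 disjR2)+

text \<open>Initial sequents cover only literals. For any other formula the left and right rules of
  its type reduce the claim to its components, which have smaller weight.\<close>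

lemma identity: "\<alpha> |\<in>| \<Gamma> \<Longrightarrow> der em pc \<Gamma> \<alpha>"
proof (induction "weight \<alpha>" arbitrary: \<alpha> \<Gamma> rule: less_induct)
  case less
  show ?case
  proof (cases \<alpha> rule: fm_type_cases)
    case 1
    then show ?thesis using less.prems by (rule init)
  next
    case (2 \<beta> \<gamma>)
    then have w: "weight \<beta> < weight \<alpha>" "weight \<gamma> < weight \<alpha>" using weight_components by blast+
    have "der em pc (finsert \<beta> (finsert \<gamma> \<Gamma>)) \<beta>" "der em pc (finsert \<beta> (finsert \<gamma> \<Gamma>)) \<gamma>"
      using less.hyps w by simp_all
    then show ?thesis by (rule conjL[OF 2 less.prems conjR[OF 2]])
  next
    case (3 \<beta> \<gamma>)
    then have w: "weight \<beta> < weight \<alpha>" "weight \<gamma> < weight \<alpha>" using weight_components by blast+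
    have "der em pc (finsert \<beta> \<Gamma>) \<beta>" "der em pc (finsert \<gamma> \<Gamma>) \<gamma>"
      using less.hyps w by simp_all
    then show ?thesis by (rule disjL[OF 3 less.prems disjR1[OF 3] disjR2[OF 3]])
  next
    case (4 \<beta> \<gamma>)
    then have w: "weight \<beta> < weight \<alpha>" "weight \<gamma> < weight \<alpha>" using weight_components by blast+
    have "der em pc (finsert \<beta> \<Gamma>) \<beta>" "der em pc (finsert \<gamma> (finsert \<beta> \<Gamma>)) \<gamma>"
      using less.hyps w by simp_all
    moreover have "\<alpha> |\<in>| finsert \<beta> \<Gamma>" using less.prems by simp
    ultimately show ?thesis using impR[OF 4] impL[OF 4] by blast
  qed
qed

section \<open>Equivalence of the cut-free calculi with the uniform rules\<close>

definition cut_free :: "bool \<Rightarrow> bool \<Rightarrow> calculus" where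
  "cut_free em pc = {init1, init2, imp_left, imp_right, and_left, and_right, or_left, or_right1,
    or_right2, neg_left, neg_right, neg_imp_left, neg_imp_right, neg_and_left, neg_and_right1,
    neg_and_right2, neg_or_left, neg_or_right} \<union> (if em then {ex_middle} else {}) \<union>
    (if pc then {peirce} else {})"

lemmas rule_defs = init1_def init2_def imp_left_def imp_right_def and_left_def and_right_def
  or_left_def or_right1_def or_right2_def neg_left_def neg_right_def neg_imp_left_def
  neg_imp_right_def neg_and_left_def neg_and_right1_def neg_and_right2_def neg_or_left_def
  neg_or_right_def ex_middle_def peirce_def

fun der_seq :: "bool \<Rightarrow> bool \<Rightarrow> sequent \<Rightarrow> bool" where
  "der_seq em pc (\<Gamma> \<Rrightarrow> \<gamma>) = der em pc \<Gamma> \<gamma>"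

text \<open>This and the next two lemmas give the left rules in the form used by the calculi, where
  the premises need not contain the principal formula. Weakening inserts it and, for implications,
  also merges the two contexts.\<close>

lemma conjL_finsert:
  assumes "conjunctive \<phi> \<alpha> \<beta>" "der em pc (finsert \<alpha> (finsert \<beta> \<Gamma>)) \<gamma>"
  shows "der em pc (finsert \<phi> \<Gamma>) \<gamma>"
  by (rule conjL[OF assms(1)]) (auto intro: weakening[OF assms(2)])

lemma disjL_finsert:
  assumes "disjunctive \<phi> \<alpha> \<beta>" "der em pc (finsert \<alpha> \<Gamma>) \<gamma>" "der em pc (finsert \<beta> \<Gamma>) \<gamma>"
  shows "der em pc (finsert \<phi> \<Gamma>) \<gamma>"
  by (rule disjL[OF assms(1)]) (auto intro: weakening[OF assms(2)] weakening[OF assms(3)])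

lemma impL_finsert:
  assumes "implicative \<phi> \<alpha> \<beta>" "der em pc \<Gamma> \<alpha>" "der em pc (finsert \<beta> \<Delta>) \<gamma>"
  shows "der em pc (finsert \<phi> (\<Gamma> |\<union>| \<Delta>)) \<gamma>"
  by (rule impL[OF assms(1)]) (auto intro: weakening[OF assms(2)] weakening[OF assms(3)])

lemma der_seq_rule:
  assumes "R \<in> cut_free em pc" "(ps, s) \<in> R" "list_all (der_seq em pc) ps"
  shows "der_seq em pc s"
proof -
  note facts = assms(2-3)
  have "R \<in> {init1, init2, imp_left, imp_right} \<or> R \<in> {and_left, and_right, or_left} \<or>
    R \<in> {or_right1, or_right2, neg_left, neg_right} \<or> R \<in> {neg_imp_left, neg_imp_right} \<or>
    R \<in> {neg_and_left, neg_and_right1, neg_and_right2} \<or> R \<in> {neg_or_left, neg_or_right} \<or>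
    em \<and> R = ex_middle \<or> pc \<and> R = peirce"
    using assms(1) by (auto simp: cut_free_def split: if_splits)
  then consider "R \<in> {init1, init2, imp_left, imp_right}" | "R \<in> {and_left, and_right, or_left}"
    | "R \<in> {or_right1, or_right2, neg_left, neg_right}" | "R \<in> {neg_imp_left, neg_imp_right}"
    | "R \<in> {neg_and_left, neg_and_right1, neg_and_right2}" | "R \<in> {neg_or_left, neg_or_right}"
    | "em" "R = ex_middle" | "pc" "R = peirce"
    by argo
  then show ?thesis
  proof cases
    case 1
    then show ?thesis using facts
      by (auto simp: rule_defs intro: identity
          impL_finsert[OF implicative.intros(1)]
          der.impR[OF implicative.intros(1)])
  next
    case 2
    then show ?thesis using facts
      by (auto simp: rule_defs intro: conjL_finsert[OF conjunctive.intros(1)]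
          der.conjR[OF conjunctive.intros(1)] disjL_finsert[OF disjunctive.intros(1)])
  next
    case 3
    \<comment> \<open>The two components of \<open>\<sim> \<sim> \<alpha>\<close> coincide, so the
      double insertion in the conjunctive rule collapses to a single one.\<close>
    have "der em pc (finsert \<alpha> \<Gamma>) \<gamma> \<Longrightarrow> der em pc (finsert (\<^bold>\<sim> \<^bold>\<sim> \<alpha>) \<Gamma>) \<gamma>" for \<alpha> \<gamma> \<Gamma>
      using conjL_finsert[OF conjunctive.intros(3)] by simp
    with 3 show ?thesis using facts
      by (auto simp: rule_defs intro: der.disjR1[OF disjunctive.intros(1)]
          der.disjR2[OF disjunctive.intros(1)] der.conjR[OF conjunctive.intros(3)])
  next
    case 4
    then show ?thesis using facts
      by (auto simp: rule_defs intro: impL_finsert[OF implicative.intros(2)]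
          der.impR[OF implicative.intros(2)])
  next
    case 5
    then show ?thesis using facts
      by (auto simp: rule_defs intro: disjL_finsert[OF disjunctive.intros(2)]
          der.disjR1[OF disjunctive.intros(2)] der.disjR2[OF disjunctive.intros(2)])
  next
    case 6
    then show ?thesis using facts
      by (auto simp: rule_defs intro: conjL_finsert[OF conjunctive.intros(2)]
          der.conjR[OF conjunctive.intros(2)])
  next
    case 7
    \<comment> \<open>The formula split on need not occur in the conclusion, so it is read off from
      the rule instance.\<close>
    then obtain \<alpha> \<Gamma> \<gamma> where "ps = [finsert (\<^bold>\<sim> \<alpha>) \<Gamma> \<Rrightarrow> \<gamma>, finsert \<alpha> \<Gamma> \<Rrightarrow> \<gamma>]" "s = (\<Gamma> \<Rrightarrow> \<gamma>)"
      using facts by (auto simp: ex_middle_def)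
    then show ?thesis using facts der.exm[OF \<open>em\<close>, of pc \<alpha> \<Gamma> \<gamma>] by simp
  next
    case 8
    then obtain \<alpha> \<beta> \<Gamma> where "ps = [finsert (\<alpha> \<^bold>\<rightarrow> \<beta>) \<Gamma> \<Rrightarrow> \<alpha>]" "s = (\<Gamma> \<Rrightarrow> \<alpha>)"
      using facts by (auto simp: peirce_def)
    then show ?thesis using facts der.prc[OF \<open>pc\<close>, of em \<alpha> \<beta> \<Gamma>] by simp
  qed
qed

lemma der_if_provable: "provable (cut_free em pc) s \<Longrightarrow> der_seq em pc s"
  by (induction rule: provable.induct) (auto intro: der_seq_rule simp: list_all_iff)

lemma provable_rule:
  assumes "(ps, s) \<in> R" "R \<in> C" "list_all (provable C) ps"
  shows "provable C s"
  using assms(3) by (intro rule_app[OF assms(2,1)]) (simp add: list_all_iff)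

lemma in_cut_free:
  "init1 \<in> cut_free em pc" "init2 \<in> cut_free em pc" "imp_left \<in> cut_free em pc"
  "imp_right \<in> cut_free em pc" "and_left \<in> cut_free em pc" "and_right \<in> cut_free em pc"
  "or_left \<in> cut_free em pc" "or_right1 \<in> cut_free em pc" "or_right2 \<in> cut_free em pc"
  "neg_left \<in> cut_free em pc" "neg_right \<in> cut_free em pc" "neg_imp_left \<in> cut_free em pc"
  "neg_imp_right \<in> cut_free em pc" "neg_and_left \<in> cut_free em pc"
  "neg_and_right1 \<in> cut_free em pc" "neg_and_right2 \<in> cut_free em pc"
  "neg_or_left \<in> cut_free em pc" "neg_or_right \<in> cut_free em pc"
  "em \<Longrightarrow> ex_middle \<in> cut_free em pc" "pc \<Longrightarrow> peirce \<in> cut_free em pc"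
  by (simp_all add: cut_free_def)

text \<open>In \<open>der\<close> the principal formula of a left rule already lies in the context.
  Inserting it once more leaves the set unchanged, so the rule of the calculus has the required
  conclusion.\<close>

lemma provable_if_der: "der em pc \<Gamma> \<gamma> \<Longrightarrow> provable (cut_free em pc) (\<Gamma> \<Rrightarrow> \<gamma>)"
proof (induction rule: der.induct)
  case (init \<gamma> \<Gamma>)
  have \<Gamma>: "finsert \<gamma> \<Gamma> = \<Gamma>" using init.hyps by auto
  from init.hyps(1) have "([], finsert \<gamma> \<Gamma> \<Rrightarrow> \<gamma>) \<in> init1 \<or> ([], finsert \<gamma> \<Gamma> \<Rrightarrow> \<gamma>) \<in> init2"
    unfolding init1_def init2_def by cases blast+
  then have "provable (cut_free em pc) (finsert \<gamma> \<Gamma> \<Rrightarrow> \<gamma>)"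
    by (elim disjE) (erule provable_rule; simp add: in_cut_free)+
  then show ?case unfolding \<Gamma> .
next
  case (conjL \<phi> \<alpha> \<beta> \<Gamma> \<gamma>)
  have \<Gamma>: "finsert \<phi> \<Gamma> = \<Gamma>" using conjL.hyps by auto
  from conjL.hyps(1) have "provable (cut_free em pc) (finsert \<phi> \<Gamma> \<Rrightarrow> \<gamma>)"
  proof cases
    case 1
    then have "([finsert \<alpha> (finsert \<beta> \<Gamma>) \<Rrightarrow> \<gamma>], finsert \<phi> \<Gamma> \<Rrightarrow> \<gamma>) \<in> and_left"
      unfolding and_left_def by blast
    then show ?thesis by (rule provable_rule) (use conjL.IH in \<open>auto simp: in_cut_free\<close>)
  next
    case 2
    then have "([finsert \<alpha> (finsert \<beta> \<Gamma>) \<Rrightarrow> \<gamma>], finsert \<phi> \<Gamma> \<Rrightarrow> \<gamma>) \<in> neg_or_left"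
      unfolding neg_or_left_def by blast
    then show ?thesis by (rule provable_rule) (use conjL.IH in \<open>auto simp: in_cut_free\<close>)
  next
    case 3
    then have "([finsert \<alpha> \<Gamma> \<Rrightarrow> \<gamma>], finsert \<phi> \<Gamma> \<Rrightarrow> \<gamma>) \<in> neg_left"
      unfolding neg_left_def by blast
    then show ?thesis
      by (rule provable_rule) (use conjL.IH \<open>\<beta> = \<alpha>\<close> in \<open>simp_all add: in_cut_free\<close>)
  qed
  then show ?case unfolding \<Gamma> .
next
  case (conjR \<phi> \<alpha> \<beta> \<Gamma>)
  from conjR.hyps(1) show ?case
  proof cases
    case 1
    then have "([\<Gamma> \<Rrightarrow> \<alpha>, \<Gamma> \<Rrightarrow> \<beta>], \<Gamma> \<Rrightarrow> \<phi>) \<in> and_right"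
      unfolding and_right_def by blast
    then show ?thesis by (rule provable_rule) (use conjR.IH in \<open>auto simp: in_cut_free\<close>)
  next
    case 2
    then have "([\<Gamma> \<Rrightarrow> \<alpha>, \<Gamma> \<Rrightarrow> \<beta>], \<Gamma> \<Rrightarrow> \<phi>) \<in> neg_or_right"
      unfolding neg_or_right_def by blast
    then show ?thesis by (rule provable_rule) (use conjR.IH in \<open>auto simp: in_cut_free\<close>)
  next
    case 3
    then have "([\<Gamma> \<Rrightarrow> \<alpha>], \<Gamma> \<Rrightarrow> \<phi>) \<in> neg_right"
      unfolding neg_right_def by blast
    then show ?thesis by (rule provable_rule) (use conjR.IH in \<open>auto simp: in_cut_free\<close>)
  qed
next
  case (disjL \<phi> \<alpha> \<beta> \<Gamma> \<gamma>)
  have \<Gamma>: "finsert \<phi> \<Gamma> = \<Gamma>" using disjL.hyps by auto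
  from disjL.hyps(1)
  have "([finsert \<alpha> \<Gamma> \<Rrightarrow> \<gamma>, finsert \<beta> \<Gamma> \<Rrightarrow> \<gamma>], finsert \<phi> \<Gamma> \<Rrightarrow> \<gamma>) \<in> or_left \<or>
    ([finsert \<alpha> \<Gamma> \<Rrightarrow> \<gamma>, finsert \<beta> \<Gamma> \<Rrightarrow> \<gamma>], finsert \<phi> \<Gamma> \<Rrightarrow> \<gamma>) \<in> neg_and_left"
    unfolding or_left_def neg_and_left_def by cases blast+
  then have "provable (cut_free em pc) (finsert \<phi> \<Gamma> \<Rrightarrow> \<gamma>)"
    by (elim disjE) (erule provable_rule; use disjL.IH in \<open>auto simp: in_cut_free\<close>)+
  then show ?case unfolding \<Gamma> .
next
  case (disjR1 \<phi> \<alpha> \<beta> \<Gamma>)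
  from disjR1.hyps(1)
  have "([\<Gamma> \<Rrightarrow> \<alpha>], \<Gamma> \<Rrightarrow> \<phi>) \<in> or_right1 \<or> ([\<Gamma> \<Rrightarrow> \<alpha>], \<Gamma> \<Rrightarrow> \<phi>) \<in> neg_and_right1"
    unfolding or_right1_def neg_and_right1_def by cases blast+
  then show ?case
    by (elim disjE) (erule provable_rule; use disjR1.IH in \<open>auto simp: in_cut_free\<close>)+
next
  case (disjR2 \<phi> \<alpha> \<beta> \<Gamma>)
  from disjR2.hyps(1)
  have "([\<Gamma> \<Rrightarrow> \<beta>], \<Gamma> \<Rrightarrow> \<phi>) \<in> or_right2 \<or> ([\<Gamma> \<Rrightarrow> \<beta>], \<Gamma> \<Rrightarrow> \<phi>) \<in> neg_and_right2"
    unfolding or_right2_def neg_and_right2_def by cases blast+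
  then show ?case
    by (elim disjE) (erule provable_rule; use disjR2.IH in \<open>auto simp: in_cut_free\<close>)+
next
  case (impL \<phi> \<alpha> \<beta> \<Gamma> \<gamma>)
  \<comment> \<open>Both contexts of the original rule are instantiated with \<Gamma>.\<close>
  have \<Gamma>: "finsert \<phi> (\<Gamma> |\<union>| \<Gamma>) = \<Gamma>"
    using impL.hyps(2) by (simp add: finsert_absorb)
  from impL.hyps(1) have "provable (cut_free em pc) (finsert \<phi> (\<Gamma> |\<union>| \<Gamma>) \<Rrightarrow> \<gamma>)"
  proof cases
    case 1
    have "([\<Gamma> \<Rrightarrow> \<alpha>, finsert \<beta> \<Gamma> \<Rrightarrow> \<gamma>], finsert \<phi> (\<Gamma> |\<union>| \<Gamma>) \<Rrightarrow> \<gamma>) \<in> imp_left"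
      unfolding imp_left_def 1 by blast
    then show ?thesis by (rule provable_rule) (use impL.IH in \<open>simp_all add: in_cut_free\<close>)
  next
    case (2 \<delta>)
    have "([\<Gamma> \<Rrightarrow> \<alpha>, finsert \<beta> \<Gamma> \<Rrightarrow> \<gamma>], finsert \<phi> (\<Gamma> |\<union>| \<Gamma>) \<Rrightarrow> \<gamma>) \<in> neg_imp_left"
      unfolding neg_imp_left_def 2 by blast
    then show ?thesis by (rule provable_rule) (use impL.IH in \<open>simp_all add: in_cut_free\<close>)
  qed
  then show ?case unfolding \<Gamma> .
next
  case (impR \<phi> \<alpha> \<beta> \<Gamma>)
  from impR.hyps(1)
  have "([finsert \<alpha> \<Gamma> \<Rrightarrow> \<beta>], \<Gamma> \<Rrightarrow> \<phi>) \<in> imp_right \<or> ([finsert \<alpha> \<Gamma> \<Rrightarrow> \<beta>], \<Gamma> \<Rrightarrow> \<phi>) \<in> neg_imp_right"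
    unfolding imp_right_def neg_imp_right_def by cases blast+
  then show ?case
    by (elim disjE) (erule provable_rule; use impR.IH in \<open>auto simp: in_cut_free\<close>)+
next
  case (exm \<alpha> \<Gamma> \<gamma>)
  have "([finsert (\<^bold>\<sim> \<alpha>) \<Gamma> \<Rrightarrow> \<gamma>, finsert \<alpha> \<Gamma> \<Rrightarrow> \<gamma>], \<Gamma> \<Rrightarrow> \<gamma>) \<in> ex_middle"
    unfolding ex_middle_def by blast
  then show ?case by (rule provable_rule) (use exm in \<open>auto simp: in_cut_free\<close>)
next
  case (prc \<gamma> \<beta> \<Gamma>)
  have "([finsert (\<gamma> \<^bold>\<rightarrow> \<beta>) \<Gamma> \<Rrightarrow> \<gamma>], \<Gamma> \<Rrightarrow> \<gamma>) \<in> peirce"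
    unfolding peirce_def by blast
  then show ?case by (rule provable_rule) (use prc in \<open>auto simp: in_cut_free\<close>)
qed

lemma provable_iff_der: "provable (cut_free em pc) (\<Gamma> \<Rrightarrow> \<gamma>) \<longleftrightarrow> der em pc \<Gamma> \<gamma>"
  using der_if_provable[of em pc "\<Gamma> \<Rrightarrow> \<gamma>"] provable_if_der by auto

text \<open>All these calculi lie inside the one with both additional rules, and each rule of that
  one differs from \<open>cut_rule\<close> as a set of instances.\<close>

lemma cut_rule_notin_cut_free: "cut_rule \<notin> cut_free em pc"
proof -
  have "cut_free em pc \<subseteq> cut_free True True"
    unfolding cut_free_def by (intro Un_mono) simp_all
  moreover have "R \<noteq> cut_rule" if "R \<in> cut_free True True" for R
    using that by (intro rule_neq_cut) (simp add: cut_free_def disj_ac)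
  ultimately show ?thesis by blast
qed

lemma insert_cut_rule:
  "sC3 = insert cut_rule (cut_free True False)"
  "sMC = insert cut_rule (cut_free False True)"
  "sCN = insert cut_rule (cut_free True True)"
  unfolding sC3_def sMC_def sCN_def sC_def cut_free_def by (simp_all add: insert_commute)

lemma minus_cut_rule:
  "sC3 - {cut_rule} = cut_free True False"
  "sMC - {cut_rule} = cut_free False True"
  "sCN - {cut_rule} = cut_free True True"
  by (simp_all add: insert_cut_rule cut_rule_notin_cut_free)

section \<open>Cut elimination without Peirce's rule\<close>

text \<open>Left rules and (ex-middle) pass the goal on unchanged, so they are reapplied with a
  component as goal; only \<open>conjR\<close> can introduce the conjunction. (Peirce) is excluded:
  its premise also carries the goal inside a hypothesis, so the goal cannot simply be
  exchanged.\<close>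

lemma der_conjD:
  "der em False \<Gamma> \<phi> \<Longrightarrow> conjunctive \<phi> \<alpha> \<beta> \<Longrightarrow> der em False \<Gamma> \<alpha> \<and> der em False \<Gamma> \<beta>"
proof (induction rule: der.induct)
  case (conjL \<phi> \<alpha>' \<beta>' \<Gamma> \<gamma>)
  then show ?case by (blast intro: der.conjL)
next
  case (disjL \<phi> \<alpha>' \<beta>' \<Gamma> \<gamma>)
  then show ?case by (blast intro: der.disjL)
next
  case (impL \<phi> \<alpha>' \<beta>' \<Gamma> \<gamma>)
  then show ?case by (blast intro: der.impL)
next
  case (exm \<alpha>' \<Gamma> \<gamma>)
  then show ?case by (blast intro: der.exm)
next
  case (conjR \<phi> \<alpha>' \<beta>' \<Gamma>)
  then show ?case using type_unique(1) by blast
qed (blast dest: not_literal type_exclusive)+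

text \<open>Inversion as for conjunctions, except that the hypothesis \<alpha> is carried along and
  commuted with the formulas added by the left rules.\<close>

lemma der_impD:
  "der em False \<Gamma> \<phi> \<Longrightarrow> implicative \<phi> \<alpha> \<beta> \<Longrightarrow> der em False (finsert \<alpha> \<Gamma>) \<beta>"
proof (induction rule: der.induct)
  case (conjL \<psi> \<alpha>' \<beta>' \<Gamma> \<gamma>)
  have "der em False (finsert \<alpha>' (finsert \<beta>' (finsert \<alpha> \<Gamma>))) \<beta>"
    by (rule weakening[OF conjL.IH[OF conjL.prems]]) auto
  moreover have "\<psi> |\<in>| finsert \<alpha> \<Gamma>" using conjL.hyps by simp
  ultimately show ?case using conjL.hyps(1) by (blast intro: der.conjL)
next
  case (disjL \<psi> \<alpha>' \<beta>' \<Gamma> \<gamma>)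
  have "der em False (finsert \<alpha>' (finsert \<alpha> \<Gamma>)) \<beta>"
    by (rule weakening[OF disjL.IH(1)[OF disjL.prems]]) auto
  moreover have "der em False (finsert \<beta>' (finsert \<alpha> \<Gamma>)) \<beta>"
    by (rule weakening[OF disjL.IH(2)[OF disjL.prems]]) auto
  moreover have "\<psi> |\<in>| finsert \<alpha> \<Gamma>" using disjL.hyps by simp
  ultimately show ?case using disjL.hyps(1) by (blast intro: der.disjL)
next
  case (impL \<psi> \<alpha>' \<beta>' \<Gamma> \<gamma>)
  have "der em False (finsert \<alpha> \<Gamma>) \<alpha>'"
    by (rule weakening[OF impL.hyps(3)]) auto
  moreover have "der em False (finsert \<beta>' (finsert \<alpha> \<Gamma>)) \<beta>"
    by (rule weakening[OF impL.IH(2)[OF impL.prems]]) auto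
  moreover have "\<psi> |\<in>| finsert \<alpha> \<Gamma>" using impL.hyps by simp
  ultimately show ?case using impL.hyps(1) by (blast intro: der.impL)
next
  case (exm \<alpha>' \<Gamma> \<gamma>)
  have "der em False (finsert (\<^bold>\<sim> \<alpha>') (finsert \<alpha> \<Gamma>)) \<beta>"
    by (rule weakening[OF exm.IH(1)[OF exm.prems]]) auto
  moreover have "der em False (finsert \<alpha>' (finsert \<alpha> \<Gamma>)) \<beta>"
    by (rule weakening[OF exm.IH(2)[OF exm.prems]]) auto
  ultimately show ?case using exm.hyps(1) by (blast intro: der.exm)
next
  case (impR \<phi> \<alpha>' \<beta>' \<Gamma>)
  then show ?case using type_unique(3) by blast
qed (blast dest: not_literal type_exclusive)+

text \<open>A disjunction on the right cannot be inverted, since the disjunct may be chosen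
  differently on different branches. Instead the goal \<gamma> replaces \<phi> up to the places
  where a disjunct is derived, and the two assumptions continue from there. They range over all
  extensions of \<Sigma> because left rules enlarge the context on the way.\<close>

lemma der_disjE:
  "der em False \<Gamma> \<phi> \<Longrightarrow> disjunctive \<phi> \<alpha> \<beta> \<Longrightarrow> \<Gamma> |\<subseteq>| \<Sigma> \<Longrightarrow>
    (\<And>\<Delta>. \<Sigma> |\<subseteq>| \<Delta> \<Longrightarrow> der em False \<Delta> \<alpha> \<Longrightarrow> der em False \<Delta> \<gamma>) \<Longrightarrow>
    (\<And>\<Delta>. \<Sigma> |\<subseteq>| \<Delta> \<Longrightarrow> der em False \<Delta> \<beta> \<Longrightarrow> der em False \<Delta> \<gamma>) \<Longrightarrow> der em False \<Sigma> \<gamma>"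
proof (induction arbitrary: \<Sigma> rule: der.induct)
  case (conjL \<psi> \<alpha>' \<beta>' \<Gamma> \<phi>)
  have "der em False (finsert \<alpha>' (finsert \<beta>' \<Sigma>)) \<gamma>"
    by (rule conjL.IH) (use conjL.prems in auto)
  then show ?case using conjL.hyps conjL.prems by (blast intro: der.conjL)
next
  case (disjL \<psi> \<alpha>' \<beta>' \<Gamma> \<phi>)
  have "der em False (finsert \<alpha>' \<Sigma>) \<gamma>" by (rule disjL.IH(1)) (use disjL.prems in auto)
  moreover have "der em False (finsert \<beta>' \<Sigma>) \<gamma>" by (rule disjL.IH(2)) (use disjL.prems in auto)
  ultimately show ?case using disjL.hyps disjL.prems by (blast intro: der.disjL)
next
  case (impL \<psi> \<alpha>' \<beta>' \<Gamma> \<phi>)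
  have "der em False (finsert \<beta>' \<Sigma>) \<gamma>" by (rule impL.IH(2)) (use impL.prems in auto)
  moreover have "der em False \<Sigma> \<alpha>'" using impL by (blast intro: weakening)
  ultimately show ?case using impL.hyps impL.prems by (blast intro: der.impL)
next
  case (exm \<alpha>' \<Gamma> \<phi>)
  have "der em False (finsert (\<^bold>\<sim> \<alpha>') \<Sigma>) \<gamma>" by (rule exm.IH(1)) (use exm.prems in auto)
  moreover have "der em False (finsert \<alpha>' \<Sigma>) \<gamma>" by (rule exm.IH(2)) (use exm.prems in auto)
  ultimately show ?case using exm.hyps by (blast intro: der.exm)
next
  case (disjR1 \<phi> \<alpha>' \<beta>' \<Gamma>)
  then have "\<alpha>' = \<alpha>" by (auto dest: type_unique)
  then show ?case using disjR1 by (blast intro: weakening)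
next
  case (disjR2 \<phi> \<alpha>' \<beta>' \<Gamma>)
  then have "\<beta>' = \<beta>" by (auto dest: type_unique)
  then show ?case using disjR2 by (blast intro: weakening)
qed (auto dest: not_literal type_exclusive)

text \<open>Outer induction on the weight of the cut formula, inner induction on the right
  derivation. Where the cut formula is principal there, the inversion lemmas for the left derivation
  reduce the cut to cuts on its components.\<close>

lemma der_cut_without_Peirce:
  "der em False \<Sigma> \<phi> \<Longrightarrow> der em False (finsert \<phi> \<Sigma>) \<gamma> \<Longrightarrow> der em False \<Sigma> \<gamma>"
proof (induction "weight \<phi>" arbitrary: \<phi> \<Sigma> \<gamma> rule: less_induct)
  case less
  have smaller_cut: "der em False \<Delta> \<delta>"
    if "weight \<psi> < weight \<phi>" "der em False \<Delta> \<psi>" "der em False (finsert \<psi> \<Delta>) \<delta>" for \<psi> \<Delta> \<delta>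
    using less.hyps that by blast
  \<comment> \<open>The context \<Pi> is only bounded by \<open>finsert \<phi> \<Sigma>\<close>, and
    \<Sigma> stays general, so that the claim applies to premises with larger contexts.\<close>
  have "der em False \<Sigma> \<gamma>"
    if "der em False \<Pi> \<gamma>" "der em False \<Sigma> \<phi>" "\<Pi> |\<subseteq>| finsert \<phi> \<Sigma>" for \<Pi> \<Sigma> \<gamma>
    using that
  proof (induction arbitrary: \<Sigma> rule: der.induct)
    case (init \<gamma> \<Gamma>)
    \<comment> \<open>If the literal is the cut formula itself, the left derivation is already the
      result.\<close>
    then show ?case by (auto intro: der.init)
  next
    case (conjL \<psi> \<alpha> \<beta> \<Gamma> \<gamma>)
    have *: "der em False (finsert \<alpha> (finsert \<beta> \<Sigma>)) \<gamma>"
      by (rule conjL.IH) (use conjL.prems in \<open>auto intro: weakening\<close>)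
    show ?case
    proof (cases "\<psi> = \<phi>")
      case True
      then have w: "weight \<alpha> < weight \<phi>" "weight \<beta> < weight \<phi>"
        using conjL.hyps weight_components by blast+
      have "der em False \<Sigma> \<alpha>" "der em False \<Sigma> \<beta>"
        using der_conjD conjL.hyps conjL.prems True by blast+
      \<comment> \<open>The cut on \<alpha> is made while \<beta> is still in the context; the cut
        on \<beta> follows.\<close>
      moreover from this have "der em False (finsert \<beta> \<Sigma>) \<alpha>" by (blast intro: weakening)
      ultimately show ?thesis using smaller_cut w * by blast
    next
      case False
      then show ?thesis using * conjL.hyps conjL.prems by (blast intro: der.conjL)
    qed
  next
    case (disjL \<psi> \<alpha> \<beta> \<Gamma> \<gamma>)
    have *: "der em False (finsert \<alpha> \<Sigma>) \<gamma>"
      by (rule disjL.IH(1)) (use disjL.prems in \<open>auto intro: weakening\<close>)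
    have **: "der em False (finsert \<beta> \<Sigma>) \<gamma>"
      by (rule disjL.IH(2)) (use disjL.prems in \<open>auto intro: weakening\<close>)
    show ?case
    proof (cases "\<psi> = \<phi>")
      case True
      then have w: "weight \<alpha> < weight \<phi>" "weight \<beta> < weight \<phi>"
        using disjL.hyps weight_components by blast+
      have d: "disjunctive \<phi> \<alpha> \<beta>" using disjL.hyps True by simp
      show ?thesis
      proof (rule der_disjE[OF disjL.prems(1) d order_refl])
        fix \<Delta> assume "\<Sigma> |\<subseteq>| \<Delta>" "der em False \<Delta> \<alpha>"
        moreover from this have "der em False (finsert \<alpha> \<Delta>) \<gamma>"
          by (intro weakening[OF *]) auto
        ultimately show "der em False \<Delta> \<gamma>" using smaller_cut w by blast
      next
        fix \<Delta> assume "\<Sigma> |\<subseteq>| \<Delta>" "der em False \<Delta> \<beta>"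
        moreover from this have "der em False (finsert \<beta> \<Delta>) \<gamma>"
          by (intro weakening[OF **]) auto
        ultimately show "der em False \<Delta> \<gamma>" using smaller_cut w by blast
      qed
    next
      case False
      then show ?thesis using * ** disjL.hyps disjL.prems by (blast intro: der.disjL)
    qed
  next
    case (impL \<psi> \<alpha> \<beta> \<Gamma> \<gamma>)
    have *: "der em False \<Sigma> \<alpha>" using impL by auto
    have **: "der em False (finsert \<beta> \<Sigma>) \<gamma>"
      by (rule impL.IH(2)) (use impL.prems in \<open>auto intro: weakening\<close>)
    show ?case
    proof (cases "\<psi> = \<phi>")
      case True
      then have w: "weight \<alpha> < weight \<phi>" "weight \<beta> < weight \<phi>"
        using impL.hyps weight_components by blast+
      have "der em False (finsert \<alpha> \<Sigma>) \<beta>"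
        using der_impD impL.hyps impL.prems True by blast
      \<comment> \<open>Cutting \<alpha> into the inverted implication gives \<beta>, which is then
        cut against \<open>**\<close>.\<close>
      then show ?thesis using smaller_cut w * ** by blast
    next
      case False
      then show ?thesis using * ** impL.hyps impL.prems by (blast intro: der.impL)
    qed
  next
    case (impR \<psi> \<alpha> \<beta> \<Gamma>)
    have "der em False (finsert \<alpha> \<Sigma>) \<beta>"
      by (rule impR.IH) (use impR.prems in \<open>auto intro: weakening\<close>)
    then show ?case using impR.hyps by (blast intro: der.impR)
  next
    case (exm \<alpha> \<Gamma> \<gamma>)
    have "der em False (finsert (\<^bold>\<sim> \<alpha>) \<Sigma>) \<gamma>"
      by (rule exm.IH(1)) (use exm.prems in \<open>auto intro: weakening\<close>)
    moreover have "der em False (finsert \<alpha> \<Sigma>) \<gamma>"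
      by (rule exm.IH(2)) (use exm.prems in \<open>auto intro: weakening\<close>)
    ultimately show ?case using exm.hyps by (blast intro: der.exm)
  qed (blast intro: der.init der.conjR der.disjR1 der.disjR2)+
  then show ?case using less.prems by blast
qed

section \<open>Two-valued semantics\<close>

text \<open>The valuations \<open>v\<close> and \<open>w\<close> interpret \<open>p\<close> and
  \<open>\<sim> p\<close> independently: both may be true, and both may be false. Implication is
  material, also inside a negation.\<close>

fun tv :: "(nat \<Rightarrow> bool) \<Rightarrow> (nat \<Rightarrow> bool) \<Rightarrow> fm \<Rightarrow> bool" where
  "tv v w (Var p) = v p"
| "tv v w (\<alpha> \<^bold>\<and> \<beta>) = (tv v w \<alpha> \<and> tv v w \<beta>)"
| "tv v w (\<alpha> \<^bold>\<or> \<beta>) = (tv v w \<alpha> \<or> tv v w \<beta>)"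
| "tv v w (\<alpha> \<^bold>\<rightarrow> \<beta>) = (tv v w \<alpha> \<longrightarrow> tv v w \<beta>)"
| "tv v w (\<^bold>\<sim> Var p) = w p"
| "tv v w (\<^bold>\<sim> (\<alpha> \<^bold>\<and> \<beta>)) = (tv v w (\<^bold>\<sim> \<alpha>) \<or> tv v w (\<^bold>\<sim> \<beta>))"
| "tv v w (\<^bold>\<sim> (\<alpha> \<^bold>\<or> \<beta>)) = (tv v w (\<^bold>\<sim> \<alpha>) \<and> tv v w (\<^bold>\<sim> \<beta>))"
| "tv v w (\<^bold>\<sim> (\<alpha> \<^bold>\<rightarrow> \<beta>)) = (tv v w \<alpha> \<longrightarrow> tv v w (\<^bold>\<sim> \<beta>))"
| "tv v w (\<^bold>\<sim> \<^bold>\<sim> \<alpha>) = tv v w \<alpha>"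

lemma tv_types:
  "conjunctive \<phi> \<alpha> \<beta> \<Longrightarrow> tv v w \<phi> = (tv v w \<alpha> \<and> tv v w \<beta>)"
  "disjunctive \<phi> \<alpha> \<beta> \<Longrightarrow> tv v w \<phi> = (tv v w \<alpha> \<or> tv v w \<beta>)"
  "implicative \<phi> \<alpha> \<beta> \<Longrightarrow> tv v w \<phi> = (tv v w \<alpha> \<longrightarrow> tv v w \<beta>)"
  by (auto simp: type_simps)

text \<open>The condition on variables propagates by de Morgan duality. For an implication, either
  \<beta> or \<open>\<sim> \<beta>\<close> holds, and so does \<alpha> \<rightarrow> \<beta> or
  \<alpha> \<rightarrow> \<open>\<sim> \<beta>\<close> respectively.\<close>

lemma tv_excluded_middle:
  assumes "\<And>p. v p \<or> w p"
  shows "tv v w \<alpha> \<or> tv v w (\<^bold>\<sim> \<alpha>)"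
  by (induction \<alpha>) (use assms in auto)

text \<open>The succedents form a set, read disjunctively, because the completeness proof decomposes
  formulas on both sides classically.\<close>

definition valid :: "bool \<Rightarrow> fm fset \<Rightarrow> fm fset \<Rightarrow> bool" where
  "valid em \<Gamma> \<Delta> \<longleftrightarrow> (\<forall>v w. (em \<longrightarrow> (\<forall>p. v p \<or> w p)) \<longrightarrow>
    (\<forall>\<alpha> |\<in>| \<Gamma>. tv v w \<alpha>) \<longrightarrow> (\<exists>\<beta> |\<in>| \<Delta>. tv v w \<beta>))"

text \<open>(Peirce) is sound since implication is material: if \<gamma> failed, \<gamma>
  \<rightarrow> \<beta> would hold and the premise would give \<gamma>. (ex-middle) rests on the
  condition on valuations.\<close>

lemma tv_der:
  assumes "em \<Longrightarrow> \<forall>p. v p \<or> w p"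
  shows "der em pc \<Gamma> \<gamma> \<Longrightarrow> \<forall>\<alpha> |\<in>| \<Gamma>. tv v w \<alpha> \<Longrightarrow> tv v w \<gamma>"
proof (induction rule: der.induct)
  case (conjL \<phi> \<alpha> \<beta> \<Gamma> \<gamma>)
  then show ?case using tv_types(1)[of \<phi> \<alpha> \<beta> v w] by auto
next
  case (disjL \<phi> \<alpha> \<beta> \<Gamma> \<gamma>)
  then show ?case using tv_types(2)[of \<phi> \<alpha> \<beta> v w] by auto
next
  case (impL \<phi> \<alpha> \<beta> \<Gamma> \<gamma>)
  then show ?case using tv_types(3)[of \<phi> \<alpha> \<beta> v w] by auto
next
  case (exm \<alpha> \<Gamma> \<gamma>)
  then show ?case using tv_excluded_middle[of v w \<alpha>] assms by auto
qed (auto simp: tv_types)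

lemma soundness: "der em pc \<Gamma> \<gamma> \<Longrightarrow> valid em \<Gamma> {|\<gamma>|}"
  using tv_der[of em _ _ pc \<Gamma> \<gamma>] by (simp add: valid_def)

section \<open>Completeness with Peirce's rule\<close>

text \<open>(Peirce) on the goal \<alpha> supplies \<alpha> \<rightarrow> \<open>g\<close>; the
  assumption then yields \<open>g\<close>, and \<open>g\<close> \<rightarrow> \<alpha> leads back to
  \<alpha>. In this way a stored succedent changes places with the goal.\<close>

lemma Peirce_swap:
  assumes "der em True (finsert (\<alpha> \<^bold>\<rightarrow> g) \<Sigma>) g"
  shows "der em True (finsert (g \<^bold>\<rightarrow> \<alpha>) \<Sigma>) \<alpha>"
proof (rule prc[of _ _ _ g])
  show "der em True (finsert (\<alpha> \<^bold>\<rightarrow> g) (finsert (g \<^bold>\<rightarrow> \<alpha>) \<Sigma>)) \<alpha>"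
    by (rule impL[OF implicative.intros(1), of g \<alpha>])
      (auto intro: identity weakening[OF assms])
qed simp

(* The right rules for \<phi> among several succedents all reduce to this one: a succedent \<delta> is
   stored as \<delta> \<rightarrow> g, and g \<rightarrow> \<alpha> makes \<alpha> the current goal. *)
lemma Peirce_focus:
  assumes "der em True (finsert (g \<^bold>\<rightarrow> \<alpha>) (finsert (g \<^bold>\<rightarrow> \<beta>) \<Sigma>)) \<phi>"
  shows "der em True (finsert (\<phi> \<^bold>\<rightarrow> g) \<Sigma>) g"
proof (rule prc[of _ _ _ \<beta>], simp, rule prc[of _ _ _ \<alpha>], simp)
  show "der em True (finsert (g \<^bold>\<rightarrow> \<alpha>) (finsert (g \<^bold>\<rightarrow> \<beta>) (finsert (\<phi> \<^bold>\<rightarrow> g) \<Sigma>))) g"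
    by (rule impL[OF implicative.intros(1), of \<phi> g])
      (auto intro: identity weakening[OF assms])
qed

text \<open>Once \<phi> is in focus, \<open>conjR\<close> asks for each component in the presence of
  \<open>g\<close> \<rightarrow> \<alpha> and \<open>g\<close> \<rightarrow> \<beta>, and
  \<open>Peirce_swap\<close> delivers it.\<close>

lemma Peirce_conjR:
  assumes "conjunctive \<phi> \<alpha> \<beta>" "der em True (finsert (\<alpha> \<^bold>\<rightarrow> g) \<Sigma>) g"
    "der em True (finsert (\<beta> \<^bold>\<rightarrow> g) \<Sigma>) g"
  shows "der em True (finsert (\<phi> \<^bold>\<rightarrow> g) \<Sigma>) g"
proof (rule Peirce_focus, rule conjR[OF assms(1)])
  show "der em True (finsert (g \<^bold>\<rightarrow> \<alpha>) (finsert (g \<^bold>\<rightarrow> \<beta>) \<Sigma>)) \<alpha>"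
    by (rule weakening[OF Peirce_swap[OF assms(2)]]) auto
  show "der em True (finsert (g \<^bold>\<rightarrow> \<alpha>) (finsert (g \<^bold>\<rightarrow> \<beta>) \<Sigma>)) \<beta>"
    by (rule weakening[OF Peirce_swap[OF assms(3)]]) auto
qed

text \<open>Only \<beta> has to become the goal, so both auxiliary implications of
  \<open>Peirce_focus\<close> are taken to be \<open>g\<close> \<rightarrow> \<beta>.\<close>

lemma Peirce_impR:
  assumes "implicative \<phi> \<alpha> \<beta>" "der em True (finsert (\<beta> \<^bold>\<rightarrow> g) (finsert \<alpha> \<Sigma>)) g"
  shows "der em True (finsert (\<phi> \<^bold>\<rightarrow> g) \<Sigma>) g"
  by (rule Peirce_focus[of _ g \<beta> \<beta>], rule impR[OF assms(1)])
    (auto intro: weakening[OF Peirce_swap[OF assms(2)]])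

text \<open>The single-succedent rules introduce \<phi> from one disjunct at a time, so \<phi> is
  focused twice, first for \<alpha> while \<beta> stays stored, then for \<beta>. The two copies of
  \<phi> \<rightarrow> \<open>g\<close> merge in the set.\<close>

lemma Peirce_disjR:
  assumes "disjunctive \<phi> \<alpha> \<beta>"
    "der em True (finsert (\<alpha> \<^bold>\<rightarrow> g) (finsert (\<beta> \<^bold>\<rightarrow> g) \<Sigma>)) g"
  shows "der em True (finsert (\<phi> \<^bold>\<rightarrow> g) \<Sigma>) g"
proof -
  have "der em True (finsert (\<phi> \<^bold>\<rightarrow> g) (finsert (\<beta> \<^bold>\<rightarrow> g) \<Sigma>)) g"
    by (rule Peirce_focus[of _ g \<alpha> \<alpha>], rule disjR1[OF assms(1)])
      (auto intro: weakening[OF Peirce_swap[OF assms(2)]])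
  then have "der em True (finsert (\<beta> \<^bold>\<rightarrow> g) (finsert (\<phi> \<^bold>\<rightarrow> g) \<Sigma>)) g"
    by (simp add: finsert_commute)
  then have "der em True (finsert (\<phi> \<^bold>\<rightarrow> g) (finsert (\<phi> \<^bold>\<rightarrow> g) \<Sigma>)) g"
    by (intro Peirce_focus[of _ g \<beta> \<beta>] disjR2[OF assms(1)])
      (auto intro: weakening[OF Peirce_swap])
  then show ?thesis by simp
qed

text \<open>Classically the left premise keeps \<open>g\<close> as a further succedent, whereas
  \<open>impL\<close> wants \<alpha> alone. (Peirce) first adds \<open>g\<close> \<rightarrow>
  \<alpha>, with which \<open>Peirce_swap\<close> turns that premise into a derivation of
  \<alpha>.\<close>

lemma Peirce_impL:
  assumes "implicative \<phi> \<alpha> \<beta>" "der em True (finsert (\<alpha> \<^bold>\<rightarrow> g) \<Sigma>) g" "der em True (finsert \<beta> \<Sigma>) g"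
  shows "der em True (finsert \<phi> \<Sigma>) g"
proof (rule prc[of _ _ _ \<alpha>], simp, rule impL[OF assms(1)])
  show "der em True (finsert (g \<^bold>\<rightarrow> \<alpha>) (finsert \<phi> \<Sigma>)) \<alpha>"
    by (rule weakening[OF Peirce_swap[OF assms(2)]]) auto
  show "der em True (finsert \<beta> (finsert (g \<^bold>\<rightarrow> \<alpha>) (finsert \<phi> \<Sigma>))) g"
    by (rule weakening[OF assms(3)]) auto
qed simp

section \<open>Counter-valuations and decomposition of valid sequents\<close>

abbreviation fweight :: "fm fset \<Rightarrow> nat" where
  "fweight \<Gamma> \<equiv> sum weight (fset \<Gamma>)"

lemma fweight_union_le: "fweight (A |\<union>| B) \<le> fweight A + fweight B"
  by (simp add: sum_Un_nat)

lemma fweight_finsert_le: "fweight (finsert \<alpha> \<Gamma>) \<le> weight \<alpha> + fweight \<Gamma>"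
  by (cases "\<alpha> |\<in>| \<Gamma>") (simp_all add: finsert_absorb)

text \<open>If neither alternative holds, the valuation refuting exactly the literals in \<Delta> is
  a counterexample.\<close>

lemma valid_literals:
  assumes "valid em \<Gamma> \<Delta>" "\<And>\<phi>. \<phi> |\<in>| \<Gamma> |\<union>| \<Delta> \<Longrightarrow> literal \<phi>"
  shows "(\<exists>\<phi>. \<phi> |\<in>| \<Gamma> \<and> \<phi> |\<in>| \<Delta>) \<or> em \<and> (\<exists>p. Var p |\<in>| \<Delta> \<and> \<^bold>\<sim> Var p |\<in>| \<Delta>)"
proof (rule ccontr)
  assume contra: "\<not> ?thesis"
  \<comment> \<open>Every literal outside \<Delta> is made true, even if absent from \<Gamma>; hence
    \<open>v p \<or> w p\<close> fails only if both literals of \<open>p\<close> lie in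
    \<Delta>.\<close>
  define v w where "v p \<longleftrightarrow> Var p |\<notin>| \<Delta>" and "w p \<longleftrightarrow> \<^bold>\<sim> Var p |\<notin>| \<Delta>" for p
  have tv: "tv v w \<phi> \<longleftrightarrow> \<phi> |\<notin>| \<Delta>" if "literal \<phi>" for \<phi>
    using that by cases (simp_all add: v_def w_def)
  have "em \<longrightarrow> (\<forall>p. v p \<or> w p)" using contra by (simp add: v_def w_def)
  moreover have "\<forall>\<alpha> |\<in>| \<Gamma>. tv v w \<alpha>"
  proof
    fix \<alpha> assume "\<alpha> |\<in>| \<Gamma>"
    then show "tv v w \<alpha>" using tv[of \<alpha>] assms(2)[of \<alpha>] contra by auto
  qed
  ultimately obtain \<beta> where "\<beta> |\<in>| \<Delta>" "tv v w \<beta>"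
    using assms(1) unfolding valid_def by blast
  then show False using tv[of \<beta>] assms(2)[of \<beta>] by simp
qed

text \<open>Each classical rule read upwards preserves validity and lowers the total weight, where a
  succedent \<delta> counts with its own weight and not with that of \<delta> \<rightarrow>
  \<open>g\<close>. Decomposition ends at literals.\<close>

lemma completeness_aux:
  "valid em \<Gamma> \<Delta> \<Longrightarrow> der em True (\<Gamma> |\<union>| (\<lambda>\<delta>. \<delta> \<^bold>\<rightarrow> g) |`| \<Delta>) g"
proof (induction "fweight \<Gamma> + fweight \<Delta>" arbitrary: \<Gamma> \<Delta> rule: less_induct)
  case less
  let ?n = "\<lambda>\<Delta>. (\<lambda>\<delta>. \<delta> \<^bold>\<rightarrow> g) |`| \<Delta>"
  note le = fweight_finsert_le fweight_union_le
  \<comment> \<open>The chosen formula is absent from the remaining set, so the weights add up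
    exactly.\<close>
  consider "\<And>\<phi>. \<phi> |\<in>| \<Gamma> |\<union>| \<Delta> \<Longrightarrow> literal \<phi>"
    | \<phi> \<Gamma>' where "\<not> literal \<phi>" "\<Gamma> = finsert \<phi> \<Gamma>'" "\<phi> |\<notin>| \<Gamma>'"
    | \<phi> \<Delta>' where "\<not> literal \<phi>" "\<Delta> = finsert \<phi> \<Delta>'" "\<phi> |\<notin>| \<Delta>'"
    by (metis funion_iff mk_disjoint_finsert)
  then show ?case
  proof cases
    case 1
    have "(\<exists>\<phi>. \<phi> |\<in>| \<Gamma> \<and> \<phi> |\<in>| \<Delta>) \<or> em \<and> (\<exists>p. Var p |\<in>| \<Delta> \<and> \<^bold>\<sim> Var p |\<in>| \<Delta>)"
      using valid_literals less.prems 1 by blast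
    moreover have goal: "der em True \<Sigma> g"
      if "\<phi> |\<in>| \<Sigma>" "\<phi> |\<in>| \<Delta>" "?n \<Delta> |\<subseteq>| \<Sigma>" for \<phi> \<Sigma>
      by (rule impL[OF implicative.intros(1), of \<phi> g]) (use that in \<open>auto intro: identity\<close>)
    ultimately show ?thesis
    proof (elim disjE exE conjE)
      fix p assume p: "em" "Var p |\<in>| \<Delta>" "\<^bold>\<sim> Var p |\<in>| \<Delta>"
      show ?thesis
        \<comment> \<open>Splitting on \<open>Var p\<close> puts one of the two complementary
          succedents into the context of each branch, and its stored implication yields
          \<open>g\<close>.\<close>
        by (rule exm[OF p(1), of _ "Var p"]; rule goal[OF finsertI1]) (use p in auto)
    qed auto
  next
    case (2 \<phi> \<Gamma>')
    have w: "fweight \<Gamma> = weight \<phi> + fweight \<Gamma>'" using 2 by simp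
    show ?thesis
    proof (cases \<phi> rule: fm_type_cases)
      case 1
      then show ?thesis using 2 by blast
    next
      case c: (2 \<alpha> \<beta>)
      \<comment> \<open>The pair is kept as one set because for a double negation it is a singleton,
        to be weighed once.\<close>
      have "fweight ({|\<alpha>, \<beta>|} |\<union>| \<Gamma>') < fweight \<Gamma>"
        using le(2)[of "{|\<alpha>, \<beta>|}" \<Gamma>'] weight_conjunctive[OF c] w by simp
      then have "der em True ({|\<alpha>, \<beta>|} |\<union>| \<Gamma>' |\<union>| ?n \<Delta>) g"
        using less.prems tv_types(1)[OF c] 2 by (intro less.hyps) (auto simp: valid_def)
      then show ?thesis using conjL_finsert[OF c] 2 by simp
    next
      case c: (3 \<alpha> \<beta>)
      have "fweight (finsert \<alpha> \<Gamma>') < fweight \<Gamma>" "fweight (finsert \<beta> \<Gamma>') < fweight \<Gamma>"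
        using le(1)[of \<alpha> \<Gamma>'] le(1)[of \<beta> \<Gamma>'] weight_disjunctive[OF c] w by linarith+
      then have "der em True (finsert \<alpha> \<Gamma>' |\<union>| ?n \<Delta>) g" "der em True (finsert \<beta> \<Gamma>' |\<union>| ?n \<Delta>) g"
        using less.prems tv_types(2)[OF c] 2 by (intro less.hyps; auto simp: valid_def)+
      then show ?thesis using disjL_finsert[OF c] 2 by simp
    next
      case c: (4 \<alpha> \<beta>)
      \<comment> \<open>One premise gains \<beta> on the left; in the other, \<alpha> moves to the
        succedents, so only the total weight is compared.\<close>
      have "fweight (finsert \<beta> \<Gamma>') < fweight \<Gamma>"
        "fweight \<Gamma>' + fweight (finsert \<alpha> \<Delta>) < fweight \<Gamma> + fweight \<Delta>"
        using le(1)[of \<beta> \<Gamma>'] le(1)[of \<alpha> \<Delta>] weight_implicative[OF c] w by linarith+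
      then have "der em True (finsert \<beta> \<Gamma>' |\<union>| ?n \<Delta>) g" "der em True (\<Gamma>' |\<union>| ?n (finsert \<alpha> \<Delta>)) g"
        using less.prems tv_types(3)[OF c] 2 by (intro less.hyps; auto simp: valid_def)+
      then show ?thesis using Peirce_impL[OF c, of _ g "\<Gamma>' |\<union>| ?n \<Delta>"] 2 by simp
    qed
  next
    case (3 \<phi> \<Delta>')
    have w: "fweight \<Delta> = weight \<phi> + fweight \<Delta>'" using 3 by simp
    show ?thesis
    proof (cases \<phi> rule: fm_type_cases)
      case 1
      then show ?thesis using 3 by blast
    next
      case c: (2 \<alpha> \<beta>)
      have "fweight (finsert \<alpha> \<Delta>') < fweight \<Delta>" "fweight (finsert \<beta> \<Delta>') < fweight \<Delta>"
        using le(1)[of \<alpha> \<Delta>'] le(1)[of \<beta> \<Delta>'] weight_components[of \<phi> \<alpha> \<beta>] c w by auto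
      then have "der em True (\<Gamma> |\<union>| ?n (finsert \<alpha> \<Delta>')) g" "der em True (\<Gamma> |\<union>| ?n (finsert \<beta> \<Delta>')) g"
        using less.prems tv_types(1)[OF c] 3 by (intro less.hyps; auto simp: valid_def)+
      then show ?thesis using Peirce_conjR[OF c, of _ g "\<Gamma> |\<union>| ?n \<Delta>'"] 3 by simp
    next
      case c: (3 \<alpha> \<beta>)
      have "fweight (finsert \<alpha> (finsert \<beta> \<Delta>')) < fweight \<Delta>"
        using le(1)[of \<alpha> "finsert \<beta> \<Delta>'"] le(1)[of \<beta> \<Delta>'] weight_disjunctive[OF c] w by linarith
      then have "der em True (\<Gamma> |\<union>| ?n (finsert \<alpha> (finsert \<beta> \<Delta>'))) g"
        using less.prems tv_types(2)[OF c] 3 by (intro less.hyps) (auto simp: valid_def)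
      then show ?thesis using Peirce_disjR[OF c, of _ g "\<Gamma> |\<union>| ?n \<Delta>'"] 3 by simp
    next
      case c: (4 \<alpha> \<beta>)
      have "fweight (finsert \<alpha> \<Gamma>) + fweight (finsert \<beta> \<Delta>') < fweight \<Gamma> + fweight \<Delta>"
        using le(1)[of \<alpha> \<Gamma>] le(1)[of \<beta> \<Delta>'] weight_implicative[OF c] w by linarith
      then have "der em True (finsert \<alpha> \<Gamma> |\<union>| ?n (finsert \<beta> \<Delta>')) g"
        using less.prems tv_types(3)[OF c] 3 by (intro less.hyps) (auto simp: valid_def)
      then show ?thesis using Peirce_impR[OF c, of _ g "\<Gamma> |\<union>| ?n \<Delta>'"] 3
        by (simp add: finsert_commute)
    qed
  qed
qed

text \<open>With \<open>g\<close> as the only succedent, the stored hypothesis is \<open>g\<close>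
  \<rightarrow> \<open>g\<close>, which (Peirce) discharges.\<close>

lemma completeness: "valid em \<Gamma> {|g|} \<Longrightarrow> der em True \<Gamma> g"
  using completeness_aux[of em \<Gamma> "{|g|}" g] by (auto intro: prc)

section \<open>Admissibility of cut\<close>

lemma der_cut:
  assumes "der em pc \<Gamma> \<alpha>" "der em pc (finsert \<alpha> \<Sigma>) \<gamma>"
  shows "der em pc (\<Gamma> |\<union>| \<Sigma>) \<gamma>"
proof (cases pc)
  case True
  \<comment> \<open>A valuation satisfying both contexts satisfies \<alpha> by the first premise and
    hence \<gamma> by the second.\<close>
  have "valid em (\<Gamma> |\<union>| \<Sigma>) {|\<gamma>|}"
    using soundness[OF assms(1)] soundness[OF assms(2)] by (auto simp: valid_def)
  then show ?thesis using True completeness by simp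
next
  case False
  \<comment> \<open>The syntactic cut shares one context, so both premises are first weakened to the
    union.\<close>
  have "der em pc (\<Gamma> |\<union>| \<Sigma>) \<alpha>" by (rule weakening[OF assms(1)]) auto
  moreover have "der em pc (finsert \<alpha> (\<Gamma> |\<union>| \<Sigma>)) \<gamma>" by (rule weakening[OF assms(2)]) auto
  ultimately show ?thesis using False der_cut_without_Peirce by simp
qed

theorem theorem2p6:
  fixes L :: calculus
  assumes "L \<in> {sC3, sMC, sCN}"
  shows "admissible cut_rule (L - {cut_rule})"
proof -
  have "admissible cut_rule (cut_free em pc)" for em pc
    unfolding admissible_cut_iff provable_iff_der using der_cut by blast
  then show ?thesis using assms minus_cut_rule by auto
qed

end
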